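(* Let $m\ge1$ and let $\Lambda=(\lambda_1,\ldots,\lambda_n)\subset\mathbb{R}^{4m}$ be an admissible configuration whose affine span is $\mathbb{R}^{4m}$. The map $$\mu:Z_{\mathbb H}(\Lambda)\to\mathbb{R}^n,\qquad \mu(q)=(|q_1|^2,\ldots,|q_n|^2),$$ has image $P_\Lambda$, and its fibres are exactly the orbits of the right action of $\operatorname{Sp}(1)^n$ on $Z_{\mathbb H}(\Lambda)$. Hence $Z_{\mathbb H}(\Lambda)/\operatorname{Sp}(1)^n\cong P_\Lambda$ (homeomorphism).
   Context: $\mathbb{H}$ denotes the quaternions and $\operatorname{Sp}(1)$ the group of unit quaternions. A configuration $\Lambda=(\lambda_1,\ldots,\lambda_n)\subset\mathbb{R}^{4m}$ is admissible if $0\in\operatorname{conv}\{\lambda_1,\ldots,\lambda_n\}$ and, for every $I\subset\{1,\ldots,n\}$, $0\in\operatorname{conv}\{\lambda_i:i\in I\}$ implies $|I|>4m$. Define $$Z_{\mathbb H}(\Lambda)=\Big\{q\in\mathbb{H}^n:\ \sum_i\lambda_i|q_i|^2=0,\ \sum_i|q_i|^2=1\Big\},\qquad P_\Lambda=\Big\{x\in\mathbb{R}_{\ge0}^n:\ \sum_i\lambda_ix_i=0,\ \sum_ix_i=1\Big\}.$$ The group $\operatorname{Sp}(1)^n$ acts on $Z_{\mathbb H}(\Lambda)$ on the right by $(q_1,\ldots,q_n)\cdot(u_1,\ldots,u_n)=(q_1u_1,\ldots,q_nu_n)$. *)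

theory Defs
  imports "HOL-Analysis.Analysis"
begin

section \<open>Quaternions\<close>

text \<open>\<open>Quat a b c d\<close> stands for \<open>a + b i + c j + d k\<close>.\<close>

datatype quat = Quat (qRe: real) (qI: real) (qJ: real) (qK: real)

lemma quat_eq_iff:
  "x = y \<longleftrightarrow> qRe x = qRe y \<and> qI x = qI y \<and> qJ x = qJ y \<and> qK x = qK y"
  by (cases x; cases y) simp

instantiation quat :: ab_group_add
begin

definition zero_quat where "0 = Quat 0 0 0 0"
definition plus_quat where
  "x + y = Quat (qRe x + qRe y) (qI x + qI y) (qJ x + qJ y) (qK x + qK y)"
definition uminus_quat where
  "- x = Quat (- qRe x) (- qI x) (- qJ x) (- qK x)"
definition minus_quat where
  "x - y = Quat (qRe x - qRe y) (qI x - qI y) (qJ x - qJ y) (qK x - qK y)"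

instance
  by standard
    (simp_all add: quat_eq_iff zero_quat_def plus_quat_def uminus_quat_def minus_quat_def)

end

lemma quat_group_sel [simp]:
  "qRe 0 = 0" "qI 0 = 0" "qJ 0 = 0" "qK 0 = 0"
  "qRe (x + y) = qRe x + qRe y" "qI (x + y) = qI x + qI y"
  "qJ (x + y) = qJ x + qJ y" "qK (x + y) = qK x + qK y"
  "qRe (- x) = - qRe x" "qI (- x) = - qI x" "qJ (- x) = - qJ x" "qK (- x) = - qK x"
  "qRe (x - y) = qRe x - qRe y" "qI (x - y) = qI x - qI y"
  "qJ (x - y) = qJ x - qJ y" "qK (x - y) = qK x - qK y"
  by (simp_all add: zero_quat_def plus_quat_def uminus_quat_def minus_quat_def)

instantiation quat :: ring_1
begin

definition one_quat where "1 = Quat 1 0 0 0"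
definition times_quat where
  "x * y = Quat
     (qRe x * qRe y - qI x * qI y - qJ x * qJ y - qK x * qK y)
     (qRe x * qI y + qI x * qRe y + qJ x * qK y - qK x * qJ y)
     (qRe x * qJ y - qI x * qK y + qJ x * qRe y + qK x * qI y)
     (qRe x * qK y + qI x * qJ y - qJ x * qI y + qK x * qRe y)"

instance
  by standard (simp_all add: quat_eq_iff one_quat_def times_quat_def algebra_simps)

end

lemma quat_mult_sel [simp]:
  "qRe 1 = 1" "qI 1 = 0" "qJ 1 = 0" "qK 1 = 0"
  "qRe (x * y) = qRe x * qRe y - qI x * qI y - qJ x * qJ y - qK x * qK y"
  "qI (x * y) = qRe x * qI y + qI x * qRe y + qJ x * qK y - qK x * qJ y"
  "qJ (x * y) = qRe x * qJ y - qI x * qK y + qJ x * qRe y + qK x * qI y"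
  "qK (x * y) = qRe x * qK y + qI x * qJ y - qJ x * qI y + qK x * qRe y"
  by (simp_all add: one_quat_def times_quat_def)

lemma quat_units:
  "Quat 0 1 0 0 * Quat 0 1 0 0 = - 1" "Quat 0 0 1 0 * Quat 0 0 1 0 = - 1"
  "Quat 0 0 0 1 * Quat 0 0 0 1 = - 1"
  "Quat 0 1 0 0 * Quat 0 0 1 0 = Quat 0 0 0 1" "Quat 0 0 1 0 * Quat 0 1 0 0 = - Quat 0 0 0 1"
  by (simp_all add: quat_eq_iff)

instantiation quat :: real_algebra_1
begin

definition scaleR_quat where
  "r *\<^sub>R x = Quat (r * qRe x) (r * qI x) (r * qJ x) (r * qK x)"

instance
  by standard (simp_all add: quat_eq_iff scaleR_quat_def algebra_simps)

end

lemma quat_scaleR_sel [simp]: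
  "qRe (r *\<^sub>R x) = r * qRe x" "qI (r *\<^sub>R x) = r * qI x"
  "qJ (r *\<^sub>R x) = r * qJ x" "qK (r *\<^sub>R x) = r * qK x"
  by (simp_all add: scaleR_quat_def)

lemma quat_sum_squares_eq_0:
  "(qRe x)\<^sup>2 + (qI x)\<^sup>2 + (qJ x)\<^sup>2 + (qK x)\<^sup>2 = 0 \<longleftrightarrow> x = 0"
  by (simp add: quat_eq_iff add_nonneg_eq_0_iff)

instantiation quat :: real_div_algebra
begin

text \<open>The inverse is the conjugate divided by the squared modulus.\<close>

definition inverse_quat where
  "inverse x = (1 / ((qRe x)\<^sup>2 + (qI x)\<^sup>2 + (qJ x)\<^sup>2 + (qK x)\<^sup>2)) *\<^sub>R
     Quat (qRe x) (- qI x) (- qJ x) (- qK x)"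
definition divide_quat where "x div y = x * inverse y" for x y :: quat

instance
proof
  fix x y :: quat
  show "x div y = x * inverse y" by (simp add: divide_quat_def)
  show "inverse (0 :: quat) = 0" by (simp add: inverse_quat_def quat_eq_iff)
  assume "x \<noteq> 0"
  then have nz: "(qRe x)\<^sup>2 + (qI x)\<^sup>2 + (qJ x)\<^sup>2 + (qK x)\<^sup>2 \<noteq> 0" (is "?s \<noteq> 0")
    by (simp add: quat_sum_squares_eq_0)
  have c: "x * Quat (qRe x) (- qI x) (- qJ x) (- qK x) = ?s *\<^sub>R 1"
    "Quat (qRe x) (- qI x) (- qJ x) (- qK x) * x = ?s *\<^sub>R 1"
    by (simp_all add: quat_eq_iff power2_eq_square)
  show "x * inverse x = 1" "inverse x * x = 1"
    using nz by (simp_all add: inverse_quat_def c)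
qed

end

definition vec4 :: "quat \<Rightarrow> (real \<times> real) \<times> (real \<times> real)" where
  "vec4 x = ((qRe x, qI x), (qJ x, qK x))"

instantiation quat :: real_normed_div_algebra
begin

definition norm_quat where
  "norm x = sqrt ((qRe x)\<^sup>2 + (qI x)\<^sup>2 + (qJ x)\<^sup>2 + (qK x)\<^sup>2)"
definition sgn_quat where "sgn x = x /\<^sub>R norm x" for x :: quat
definition dist_quat where "dist x y = norm (x - y)" for x y :: quat
definition uniformity_quat where
  "(uniformity :: (quat \<times> quat) filter) = (INF e\<in>{0 <..}. principal {(x, y). dist x y < e})"
definition open_quat where
  "open (U :: quat set) \<longleftrightarrow> (\<forall>x\<in>U. \<forall>\<^sub>F (x', y) in uniformity. x' = x \<longrightarrow> y \<in> U)"

instance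
proof
  fix r :: real and x y :: quat and U :: "quat set"
  have v: "norm z = norm (vec4 z)" for z
    by (simp add: norm_quat_def vec4_def norm_Pair)
  show "norm x = 0 \<longleftrightarrow> x = 0"
    using quat_sum_squares_eq_0 [of x] by (simp add: norm_quat_def)
  show "norm (x + y) \<le> norm x + norm y"
    unfolding v using norm_triangle_ineq [of "vec4 x" "vec4 y"] by (simp add: vec4_def)
  have "vec4 (r *\<^sub>R x) = r *\<^sub>R vec4 x" by (simp add: vec4_def)
  then show "norm (r *\<^sub>R x) = \<bar>r\<bar> * norm x" by (simp add: v)
  show "norm (x * y) = norm x * norm y"
    unfolding norm_quat_def real_sqrt_mult [symmetric]
    by (simp add: power2_eq_square algebra_simps)
qed (rule sgn_quat_def dist_quat_def uniformity_quat_def open_quat_def)+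

end

section \<open>Configurations and the associated spaces\<close>

text \<open>
  A configuration of \<open>n = CARD('n)\<close> vectors is a family indexed by \<open>'n\<close>, so repetitions are
  allowed and \<open>card I\<close> counts indices. For the ambient space \<open>\<real>\<^sup>4\<^sup>m\<close> one takes \<open>CARD('d) = 4 * m\<close>.
\<close>

definition admissible :: "('n::finite \<Rightarrow> real ^ 'd) \<Rightarrow> bool" where
  "admissible \<Lambda> \<longleftrightarrow>
     0 \<in> convex hull (range \<Lambda>) \<and>
     (\<forall>I. 0 \<in> convex hull (\<Lambda> ` I) \<longrightarrow> CARD('d) < card I)"

definition ZH :: "('n::finite \<Rightarrow> real ^ 'd) \<Rightarrow> (quat ^ 'n) set" where
  "ZH \<Lambda> = {q. (\<Sum>i\<in>UNIV. (norm (q $ i))\<^sup>2 *\<^sub>R \<Lambda> i) = 0 \<and> (\<Sum>i\<in>UNIV. (norm (q $ i))\<^sup>2) = 1}"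

definition polytope_of :: "('n::finite \<Rightarrow> real ^ 'd) \<Rightarrow> (real ^ 'n) set" where
  "polytope_of \<Lambda> =
     {x. (\<forall>i. 0 \<le> x $ i) \<and> (\<Sum>i\<in>UNIV. x $ i *\<^sub>R \<Lambda> i) = 0 \<and> (\<Sum>i\<in>UNIV. x $ i) = 1}"

definition moment_map :: "quat ^ 'n \<Rightarrow> real ^ 'n" where
  "moment_map q = (\<chi> i. (norm (q $ i))\<^sup>2)"

section \<open>The right action of \<open>Sp(1)\<^sup>n\<close>\<close>

definition Sp1 :: "quat set" where
  "Sp1 = {u. norm u = 1}"

definition Sp1_pow :: "(quat ^ 'n) set" where
  "Sp1_pow = {u. \<forall>i. u $ i \<in> Sp1}"

definition right_act :: "quat ^ 'n \<Rightarrow> quat ^ 'n \<Rightarrow> quat ^ 'n" where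
  "right_act q u = (\<chi> i. q $ i * u $ i)"

definition Sp1_orbit :: "quat ^ 'n \<Rightarrow> (quat ^ 'n) set" where
  "Sp1_orbit q = right_act q ` Sp1_pow"

lemma right_act_one: "right_act q (\<chi> i. 1) = q"
  by (simp add: right_act_def vec_eq_iff)

lemma right_act_act: "right_act (right_act q u) v = right_act q (right_act u v)"
  by (simp add: right_act_def vec_eq_iff mult.assoc)

lemma right_act_ZH: "q \<in> ZH \<Lambda> \<Longrightarrow> u \<in> Sp1_pow \<Longrightarrow> right_act q u \<in> ZH \<Lambda>"
  by (simp add: ZH_def right_act_def Sp1_pow_def Sp1_def norm_mult)

section \<open>The orbit space\<close>

text \<open>The finest topology on \<open>f ` topspace X\<close> for which \<open>f\<close> is continuous.\<close>

definition quotient_topology :: "'a topology \<Rightarrow> ('a \<Rightarrow> 'b) \<Rightarrow> 'b topology" where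
  "quotient_topology X f =
     topology (\<lambda>U. U \<subseteq> f ` topspace X \<and> openin X {x \<in> topspace X. f x \<in> U})"

lemma openin_quotient_topology:
  "openin (quotient_topology X f) U \<longleftrightarrow>
     U \<subseteq> f ` topspace X \<and> openin X {x \<in> topspace X. f x \<in> U}"
proof -
  have "istopology (\<lambda>U. U \<subseteq> f ` topspace X \<and> openin X {x \<in> topspace X. f x \<in> U})"
    unfolding istopology_def
  proof (intro conjI allI impI)
    fix S T
    assume "S \<subseteq> f ` topspace X \<and> openin X {x \<in> topspace X. f x \<in> S}"
      and "T \<subseteq> f ` topspace X \<and> openin X {x \<in> topspace X. f x \<in> T}"
    moreover have "{x \<in> topspace X. f x \<in> S \<inter> T} =
        {x \<in> topspace X. f x \<in> S} \<inter> {x \<in> topspace X. f x \<in> T}" by auto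
    ultimately show "S \<inter> T \<subseteq> f ` topspace X" "openin X {x \<in> topspace X. f x \<in> S \<inter> T}"
      by auto
  next
    fix \<K>
    assume K: "\<forall>U\<in>\<K>. U \<subseteq> f ` topspace X \<and> openin X {x \<in> topspace X. f x \<in> U}"
    then show "\<Union>\<K> \<subseteq> f ` topspace X" by blast
    have "{x \<in> topspace X. f x \<in> \<Union>\<K>} = (\<Union>U\<in>\<K>. {x \<in> topspace X. f x \<in> U})" by auto
    then show "openin X {x \<in> topspace X. f x \<in> \<Union>\<K>}" using K by auto
  qed
  then show ?thesis by (simp add: quotient_topology_def topology_inverse')
qed

lemma topspace_quotient_topology: "topspace (quotient_topology X f) = f ` topspace X"
proof
  show "topspace (quotient_topology X f) \<subseteq> f ` topspace X"
    using openin_topspace openin_quotient_topology by metis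
  have "{x \<in> topspace X. f x \<in> f ` topspace X} = topspace X" by auto
  then show "f ` topspace X \<subseteq> topspace (quotient_topology X f)"
    by (intro openin_subset) (simp add: openin_quotient_topology)
qed

lemma quotient_map_quotient_topology: "quotient_map X (quotient_topology X f) f"
  by (auto simp: quotient_map_def topspace_quotient_topology openin_quotient_topology)

definition orbit_space :: "('n::finite \<Rightarrow> real ^ 'd) \<Rightarrow> (quat ^ 'n) set topology" where
  "orbit_space \<Lambda> = quotient_topology (top_of_set (ZH \<Lambda>)) Sp1_orbit"

end

theory Submission
  imports Defs
begin

text \<open>
  The coordinatewise square root, with values in the real quaternions, is a continuous section of
  the moment map over the polytope. It gives surjectivity, and composed with the orbit projection
  it is a continuous inverse of the map induced on the orbit space, so no compactness argument is
  needed.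
\<close>

definition sqrt_section :: "real ^ 'n \<Rightarrow> quat ^ 'n" where
  "sqrt_section x = (\<chi> i. of_real (sqrt (x $ i)))"

lemma moment_map_sqrt_section:
  assumes "\<And>i. 0 \<le> x $ i"
  shows "moment_map (sqrt_section x) = x"
  using assms by (simp add: moment_map_def sqrt_section_def vec_eq_iff)

text \<open>Squared norms are automatically nonnegative, so only the two linear equations remain.
  Thus \<open>ZH\<close> is a full preimage, and fibres can be studied in the whole quaternionic
  space.\<close>

lemma moment_map_in_polytope_iff: "moment_map q \<in> polytope_of \<Lambda> \<longleftrightarrow> q \<in> ZH \<Lambda>"
  by (simp add: moment_map_def polytope_of_def ZH_def)

lemma sqrt_section_in_ZH: "x \<in> polytope_of \<Lambda> \<Longrightarrow> sqrt_section x \<in> ZH \<Lambda>"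
  by (subst moment_map_in_polytope_iff [symmetric], subst moment_map_sqrt_section)
    (auto simp: polytope_of_def)

lemma continuous_on_moment_map: "continuous_on S moment_map"
  unfolding moment_map_def by (intro continuous_intros)

text \<open>No restriction on \<open>S\<close> arises, since \<open>sqrt\<close> extends to negative
  reals as an odd function and is continuous everywhere, also at 0.\<close>

lemma continuous_on_sqrt_section: "continuous_on S sqrt_section"
  unfolding sqrt_section_def by (intro continuous_intros)

lemma moment_map_image_ZH: "moment_map ` ZH \<Lambda> = polytope_of \<Lambda>"
proof
  show "moment_map ` ZH \<Lambda> \<subseteq> polytope_of \<Lambda>"
    by (auto simp: moment_map_in_polytope_iff)
  show "polytope_of \<Lambda> \<subseteq> moment_map ` ZH \<Lambda>"
  proof
    fix x assume x: "x \<in> polytope_of \<Lambda>"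
    then have "moment_map (sqrt_section x) = x"
      by (intro moment_map_sqrt_section) (simp add: polytope_of_def)
    then show "x \<in> moment_map ` ZH \<Lambda>"
      using sqrt_section_in_ZH [OF x] by (metis imageI)
  qed
qed

text \<open>Transitivity of Sp(1) on each sphere centred at 0: the required unit is the left
  quotient of \<open>p\<close> by \<open>q\<close>, whose norm is 1 by multiplicativity.\<close>

lemma norm_eq_imp_unit_multiple:
  fixes p q :: quat
  assumes "norm p = norm q"
  obtains u where "u \<in> Sp1" and "p = q * u"
proof (cases "q = 0")
  case True
  \<comment> \<open>Here \<open>p\<close> vanishes too, so any unit would do.\<close>
  with assms that [of 1] show ?thesis by (simp add: Sp1_def)
next
  case False
  with assms have "inverse q * p \<in> Sp1"
    by (simp add: Sp1_def norm_mult norm_inverse)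
  moreover have "p = q * (inverse q * p)"
    using False by (simp flip: mult.assoc)
  ultimately show ?thesis by (rule that)
qed

text \<open>The group is a full product, so the units relating two points of a fibre can be chosen
  independently in each coordinate.\<close>

lemma Sp1_orbit_eq_fibre: "Sp1_orbit q = {q'. moment_map q' = moment_map q}"
proof
  show "Sp1_orbit q \<subseteq> {q'. moment_map q' = moment_map q}"
    by (auto simp: Sp1_orbit_def right_act_def Sp1_pow_def Sp1_def moment_map_def norm_mult)
  show "{q'. moment_map q' = moment_map q} \<subseteq> Sp1_orbit q"
  proof
    fix q' assume "q' \<in> {q'. moment_map q' = moment_map q}"
    then have "norm (q' $ i) = norm (q $ i)" for i
      by (simp add: moment_map_def vec_eq_iff)
    then have "\<forall>i. \<exists>u. u \<in> Sp1 \<and> q' $ i = q $ i * u"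
      by (metis norm_eq_imp_unit_multiple)
    then obtain u where u: "\<And>i. u i \<in> Sp1" "\<And>i. q' $ i = q $ i * u i"
      by metis
    then have "q' = right_act q (\<chi> i. u i)"
      by (simp add: right_act_def vec_eq_iff)
    moreover have "(\<chi> i. u i) \<in> Sp1_pow"
      using u by (simp add: Sp1_pow_def)
    ultimately show "q' \<in> Sp1_orbit q"
      by (simp add: Sp1_orbit_def)
  qed
qed

lemma Sp1_orbit_eq_iff: "Sp1_orbit p = Sp1_orbit q \<longleftrightarrow> moment_map p = moment_map q"
  by (auto simp: Sp1_orbit_eq_fibre)

text \<open>The choice of representative is harmless on orbits, where \<open>moment_map\<close> is
  constant.\<close>

definition orbit_moment :: "(quat ^ 'n) set \<Rightarrow> real ^ 'n" where
  "orbit_moment A = moment_map (SOME q. q \<in> A)"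

lemma orbit_moment_orbit: "orbit_moment (Sp1_orbit q) = moment_map q"
proof -
  have "(SOME q'. q' \<in> Sp1_orbit q) \<in> Sp1_orbit q"
    by (rule someI [of _ q]) (simp add: Sp1_orbit_eq_fibre)
  then show ?thesis by (simp add: orbit_moment_def Sp1_orbit_eq_fibre)
qed

lemma homeomorphic_maps_orbit_moment:
  "homeomorphic_maps (orbit_space \<Lambda>) (top_of_set (polytope_of \<Lambda>))
     orbit_moment (Sp1_orbit \<circ> sqrt_section)"
  unfolding homeomorphic_maps_def
proof (intro conjI ballI)
  have quot: "quotient_map (top_of_set (ZH \<Lambda>)) (orbit_space \<Lambda>) Sp1_orbit"
    unfolding orbit_space_def by (rule quotient_map_quotient_topology)
  \<comment> \<open>Continuity of \<open>orbit_moment\<close> is not visible from its definition by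
    choice; it descends from \<open>moment_map\<close> through the quotient map.\<close>
  have "orbit_moment \<circ> Sp1_orbit = moment_map"
    by (simp add: fun_eq_iff orbit_moment_orbit)
  moreover have "continuous_map (top_of_set (ZH \<Lambda>)) (top_of_set (polytope_of \<Lambda>)) moment_map"
    by (auto simp: continuous_on_moment_map moment_map_in_polytope_iff)
  ultimately show "continuous_map (orbit_space \<Lambda>) (top_of_set (polytope_of \<Lambda>)) orbit_moment"
    using continuous_compose_quotient_map [OF quot] by metis
  have "continuous_map (top_of_set (polytope_of \<Lambda>)) (top_of_set (ZH \<Lambda>)) sqrt_section"
    by (auto simp: continuous_on_sqrt_section sqrt_section_in_ZH)
  then show "continuous_map (top_of_set (polytope_of \<Lambda>)) (orbit_space \<Lambda>)
      (Sp1_orbit \<circ> sqrt_section)"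
    using quot by (blast intro: continuous_map_compose quotient_imp_continuous_map)
next
  fix A assume "A \<in> topspace (orbit_space \<Lambda>)"
  then obtain q where "A = Sp1_orbit q"
    by (auto simp: orbit_space_def topspace_quotient_topology)
  \<comment> \<open>The section need not return \<open>q\<close> itself, only a point with the same
    coordinate norms, hence in the same orbit.\<close>
  moreover have "moment_map (sqrt_section (moment_map q)) = moment_map q"
    by (rule moment_map_sqrt_section) (simp add: moment_map_def)
  ultimately show "(Sp1_orbit \<circ> sqrt_section) (orbit_moment A) = A"
    by (simp add: orbit_moment_orbit Sp1_orbit_eq_iff)
next
  fix x assume "x \<in> topspace (top_of_set (polytope_of \<Lambda>))"
  then show "orbit_moment ((Sp1_orbit \<circ> sqrt_section) x) = x"
    by (simp add: orbit_moment_orbit moment_map_sqrt_section polytope_of_def)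
qed

theorem theorem3p1:
  fixes m :: nat and \<Lambda> :: "'n::finite \<Rightarrow> real ^ 'd"
  assumes "m \<ge> 1"
    and "CARD('d) = 4 * m"
    and "admissible \<Lambda>"
    and "affine hull (range \<Lambda>) = UNIV"
  shows "moment_map ` ZH \<Lambda> = polytope_of \<Lambda> \<and>
    (\<forall>q\<in>ZH \<Lambda>. {q' \<in> ZH \<Lambda>. moment_map q' = moment_map q} = Sp1_orbit q) \<and>
    (\<exists>h. homeomorphic_map (orbit_space \<Lambda>) (top_of_set (polytope_of \<Lambda>)) h \<and>
      (\<forall>q\<in>ZH \<Lambda>. h (Sp1_orbit q) = moment_map q))"
proof (intro conjI ballI exI)
  show "moment_map ` ZH \<Lambda> = polytope_of \<Lambda>"
    by (rule moment_map_image_ZH)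
  show "{q' \<in> ZH \<Lambda>. moment_map q' = moment_map q} = Sp1_orbit q" if "q \<in> ZH \<Lambda>" for q
  proof -
    have "q' \<in> ZH \<Lambda>" if "moment_map q' = moment_map q" for q'
      using that \<open>q \<in> ZH \<Lambda>\<close> by (metis moment_map_in_polytope_iff)
    then show ?thesis by (auto simp: Sp1_orbit_eq_fibre)
  qed
  show "homeomorphic_map (orbit_space \<Lambda>) (top_of_set (polytope_of \<Lambda>)) orbit_moment"
    using homeomorphic_maps_orbit_moment homeomorphic_map_maps by blast
  show "orbit_moment (Sp1_orbit q) = moment_map q" if "q \<in> ZH \<Lambda>" for q
    by (rule orbit_moment_orbit)
qed

end
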